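(* Let $G=(V,E)$ be a finite weighted graph with vertex measure $\mu:V\to(0,\infty)$, and let $s:E^{or}\to U(1)$ be a signature of $G$. Then $$\frac12\,\lambda_1(\Delta_\mu^s)\;\le\; h_1^s(\mu)\;\le\; \frac32\sqrt{2\,d_\mu\,\lambda_1(\Delta_\mu^s)} .$$
   Context: $G=(V,E)$ is a finite simple undirected graph; every edge $\{u,v\}\in E$ carries a positive symmetric weight $w_{uv}=w_{vu}$. Write $u\sim v$ if $\{u,v\}\in E$, $d_u=\sum_{v\sim u}w_{uv}$, and $d_\mu=\max_{u\in V} d_u/\mu(u)$. $E^{or}=\{(u,v),(v,u)\mid \{u,v\}\in E\}$ is the set of oriented edges. $\Gamma=U(1)=\{z\in\mathbb{C}\mid |z|=1\}$. A signature is a map $s:E^{or}\to\Gamma$, $s_{uv}:=s((u,v))$, with $s_{vu}=s_{uv}^{-1}$. The Laplacian $\Delta_\mu^s$ acts on $f:V\to\mathbb{C}$ by $\Delta_\mu^s f(u)=\frac1{\mu(u)}\sum_{v\sim u}w_{uv}(f(u)-s_{uv}f(v))$; it is self-adjoint and non-negative with respect to $\langle f,g\rangle_\mu=\sum_{u}f(u)\overline{g(u)}\mu(u)$, and $\lambda_1(\Delta_\mu^s)$ is its smallest eigenvalue. For nonempty $V_1\subseteq V$ with induced subgraph $(V_1,E_1)$: the frustration index is $\iota^s(V_1)=\min_{\tau:V_1\to\Gamma}\sum_{\{u,v\}\in E_1}w_{uv}|\tau(u)-s_{uv}\tau(v)|$ (the summand does not depend on the orientation of the edge); $|E(V_1,V_1^c)|=\sum_{u\in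 V_1}\sum_{v\in V\setminus V_1,\,v\sim u}w_{uv}$; $\mathrm{vol}_\mu(V_1)=\sum_{u\in V_1}\mu(u)$; and $$\phi_\mu^s(V_1)=\frac{\iota^s(V_1)+|E(V_1,V_1^c)|}{\mathrm{vol}_\mu(V_1)}.$$ The Cheeger constant is $h_1^s(\mu)=\min_{\emptyset\ne V_1\subseteq V}\phi_\mu^s(V_1)$. *)

theory Defs
  imports "HOL-Analysis.Analysis"
begin

definition simple_graph :: "'a set \<Rightarrow> 'a set set \<Rightarrow> bool" where
  "simple_graph V E \<longleftrightarrow>
     finite V \<and> V \<noteq> {} \<and> (\<forall>e\<in>E. \<exists>u\<in>V. \<exists>v\<in>V. u \<noteq> v \<and> e = {u, v})"

definition edge_weight :: "'a set set \<Rightarrow> ('a \<Rightarrow> 'a \<Rightarrow> real) \<Rightarrow> bool" where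
  "edge_weight E w \<longleftrightarrow> (\<forall>u v. {u, v} \<in> E \<longrightarrow> 0 < w u v \<and> w u v = w v u)"

definition oriented_edges :: "'a set set \<Rightarrow> ('a \<times> 'a) set" where
  "oriented_edges E = {(u, v). {u, v} \<in> E}"

text \<open>The group \<open>U(1)\<close> is the unit circle \<open>sphere 0 1\<close> in the complex plane.\<close>

definition signature :: "'a set set \<Rightarrow> ('a \<Rightarrow> 'a \<Rightarrow> complex) \<Rightarrow> bool" where
  "signature E s \<longleftrightarrow>
     (\<forall>(u, v)\<in>oriented_edges E. s u v \<in> sphere 0 1 \<and> s v u = inverse (s u v))"

definition wdegree :: "'a set \<Rightarrow> 'a set set \<Rightarrow> ('a \<Rightarrow> 'a \<Rightarrow> real) \<Rightarrow> 'a \<Rightarrow> real" where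
  "wdegree V E w u = (\<Sum>v | v \<in> V \<and> {u, v} \<in> E. w u v)"

definition max_degree ::
    "'a set \<Rightarrow> 'a set set \<Rightarrow> ('a \<Rightarrow> 'a \<Rightarrow> real) \<Rightarrow> ('a \<Rightarrow> real) \<Rightarrow> real" where
  "max_degree V E w \<mu> = Max ((\<lambda>u. wdegree V E w u / \<mu> u) ` V)"

definition laplacian ::
    "'a set \<Rightarrow> 'a set set \<Rightarrow> ('a \<Rightarrow> 'a \<Rightarrow> real) \<Rightarrow> ('a \<Rightarrow> real) \<Rightarrow> ('a \<Rightarrow> 'a \<Rightarrow> complex)
      \<Rightarrow> ('a \<Rightarrow> complex) \<Rightarrow> 'a \<Rightarrow> complex" where
  "laplacian V E w \<mu> s f u =
     1 / of_real (\<mu> u) * (\<Sum>v | v \<in> V \<and> {u, v} \<in> E. of_real (w u v) * (f u - s u v * f v))"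

text \<open>Functions on \<open>V\<close> are represented by total functions of which only the values on \<open>V\<close>
  matter.\<close>

definition is_eigenvalue ::
    "'a set \<Rightarrow> (('a \<Rightarrow> complex) \<Rightarrow> 'a \<Rightarrow> complex) \<Rightarrow> complex \<Rightarrow> bool" where
  "is_eigenvalue V T c \<longleftrightarrow> (\<exists>f. (\<exists>u\<in>V. f u \<noteq> 0) \<and> (\<forall>u\<in>V. T f u = c * f u))"

text \<open>The Laplacian is self-adjoint, so restricting to real eigenvalues loses nothing; it makes
  the order available.\<close>

definition lambda1 ::
    "'a set \<Rightarrow> 'a set set \<Rightarrow> ('a \<Rightarrow> 'a \<Rightarrow> real) \<Rightarrow> ('a \<Rightarrow> real) \<Rightarrow> ('a \<Rightarrow> 'a \<Rightarrow> complex) \<Rightarrow> real" where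
  "lambda1 V E w \<mu> s = Min {x. is_eigenvalue V (laplacian V E w \<mu> s) (of_real x)}"

definition induced_edges :: "'a set set \<Rightarrow> 'a set \<Rightarrow> 'a set set" where
  "induced_edges E V1 = {e \<in> E. e \<subseteq> V1}"

text \<open>The contribution of an unoriented edge is described by its two orientations, which give the
  same value (lemma \<open>edge_frustration_eq\<close>).\<close>

definition edge_frustration ::
    "('a \<Rightarrow> 'a \<Rightarrow> real) \<Rightarrow> ('a \<Rightarrow> 'a \<Rightarrow> complex) \<Rightarrow> ('a \<Rightarrow> complex) \<Rightarrow> 'a set \<Rightarrow> real" where
  "edge_frustration w s \<tau> e =
     (THE x. \<exists>u v. e = {u, v} \<and> x = w u v * cmod (\<tau> u - s u v * \<tau> v))"

definition frustration ::
    "'a set set \<Rightarrow> ('a \<Rightarrow> 'a \<Rightarrow> real) \<Rightarrow> ('a \<Rightarrow> 'a \<Rightarrow> complex) \<Rightarrow> 'a set \<Rightarrow> ('a \<Rightarrow> complex) \<Rightarrow> real" where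
  "frustration E w s V1 \<tau> = (\<Sum>e\<in>induced_edges E V1. edge_frustration w s \<tau> e)"

text \<open>The infimum is a minimum (lemma \<open>frustration_index_attained\<close>).\<close>

definition frustration_index ::
    "'a set set \<Rightarrow> ('a \<Rightarrow> 'a \<Rightarrow> real) \<Rightarrow> ('a \<Rightarrow> 'a \<Rightarrow> complex) \<Rightarrow> 'a set \<Rightarrow> real" where
  "frustration_index E w s V1 = (INF \<tau>\<in>V1 \<rightarrow>\<^sub>E sphere 0 1. frustration E w s V1 \<tau>)"

definition boundary_weight ::
    "'a set \<Rightarrow> 'a set set \<Rightarrow> ('a \<Rightarrow> 'a \<Rightarrow> real) \<Rightarrow> 'a set \<Rightarrow> real" where
  "boundary_weight V E w V1 = (\<Sum>u\<in>V1. \<Sum>v | v \<in> V - V1 \<and> {u, v} \<in> E. w u v)"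

definition volume :: "('a \<Rightarrow> real) \<Rightarrow> 'a set \<Rightarrow> real" where
  "volume \<mu> V1 = (\<Sum>u\<in>V1. \<mu> u)"

definition cheeger_ratio ::
    "'a set \<Rightarrow> 'a set set \<Rightarrow> ('a \<Rightarrow> 'a \<Rightarrow> real) \<Rightarrow> ('a \<Rightarrow> real) \<Rightarrow> ('a \<Rightarrow> 'a \<Rightarrow> complex)
      \<Rightarrow> 'a set \<Rightarrow> real" where
  "cheeger_ratio V E w \<mu> s V1 =
     (frustration_index E w s V1 + boundary_weight V E w V1) / volume \<mu> V1"

definition cheeger_constant ::
    "'a set \<Rightarrow> 'a set set \<Rightarrow> ('a \<Rightarrow> 'a \<Rightarrow> real) \<Rightarrow> ('a \<Rightarrow> real) \<Rightarrow> ('a \<Rightarrow> 'a \<Rightarrow> complex) \<Rightarrow> real" where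
  "cheeger_constant V E w \<mu> s =
     Min (cheeger_ratio V E w \<mu> s ` {V1. V1 \<noteq> {} \<and> V1 \<subseteq> V})"

lemma edge_frustration_eq:
  assumes w: "edge_weight E w" and s: "signature E s" and e: "{u, v} \<in> E"
  shows "edge_frustration w s \<tau> {u, v} = w u v * cmod (\<tau> u - s u v * \<tau> v)"
proof -
  have su: "cmod (s u v) = 1" "s v u = inverse (s u v)"
    using s e by (auto simp: signature_def oriented_edges_def)
  have "s u v \<noteq> 0" using su(1) by auto
  then have "\<tau> u - s u v * \<tau> v = - s u v * (\<tau> v - s v u * \<tau> u)"
    using su(2) by (simp add: algebra_simps)
  then have "cmod (\<tau> u - s u v * \<tau> v) = cmod (\<tau> v - s v u * \<tau> u)"
    using su(1) by (simp add: norm_mult)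
  moreover have "w u v = w v u" using w e by (auto simp: edge_weight_def)
  ultimately show ?thesis
    unfolding edge_frustration_def
    by (intro the_equality) (auto simp: doubleton_eq_iff)
qed

lemma frustration_index_attained:
  assumes g: "simple_graph V E" and w: "edge_weight E w" and s: "signature E s"
    and V1: "V1 \<subseteq> V"
  shows "\<exists>\<tau>\<in>V1 \<rightarrow>\<^sub>E sphere 0 1. frustration_index E w s V1 = frustration E w s V1 \<tau>
           \<and> (\<forall>\<sigma>\<in>V1 \<rightarrow>\<^sub>E sphere 0 1. frustration E w s V1 \<tau> \<le> frustration E w s V1 \<sigma>)"
proof -
  let ?S = "V1 \<rightarrow>\<^sub>E sphere (0::complex) 1"
  let ?X = "product_topology (\<lambda>_. euclidean) V1 :: ('a \<Rightarrow> complex) topology"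
  let ?F = "frustration E w s V1"
  have comp: "compactin ?X ?S"
    by (simp add: compactin_PiE)
  have "continuous_map ?X euclideanreal (\<lambda>\<tau>. edge_frustration w s \<tau> e)"
    if e: "e \<in> induced_edges E V1" for e
  proof -
    obtain u v where uv: "e = {u, v}" "u \<in> V1" "v \<in> V1" "{u, v} \<in> E"
      using e g unfolding induced_edges_def simple_graph_def by fastforce
    have pr: "continuous_map ?X euclidean (\<lambda>\<tau>. \<tau> x)" if "x \<in> V1" for x
      using continuous_map_product_projection[OF that, of "\<lambda>_. euclidean"] by simp
    have "continuous_map ?X euclidean (\<lambda>\<tau>. s u v * \<tau> v)"
      using continuous_map_compose[OF pr[OF uv(3)], of euclidean "(*) (s u v)"]
      by (simp add: o_def continuous_map_iff_continuous2 continuous_intros)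
    then show ?thesis
      unfolding uv(1) edge_frustration_eq[OF w s uv(4)]
      by (intro continuous_map_real_mult_left continuous_map_norm continuous_map_diff pr uv(2))
  qed
  moreover have "finite (induced_edges E V1)"
  proof -
    have "induced_edges E V1 \<subseteq> Pow V" using V1 by (auto simp: induced_edges_def)
    then show ?thesis using g finite_subset by (auto simp: simple_graph_def)
  qed
  ultimately have cont: "continuous_map ?X euclideanreal ?F"
    unfolding frustration_def by (intro continuous_map_sum) auto
  have "compact (?F ` ?S)"
    using image_compactin[OF comp cont] by simp
  moreover have "(\<lambda>x\<in>V1. 1) \<in> ?S" by auto
  then have "?F ` ?S \<noteq> {}" by blast
  ultimately obtain m where m: "m \<in> ?F ` ?S" "\<forall>y\<in>?F ` ?S. m \<le> y"
    using compact_attains_inf by metis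
  then have "Inf (?F ` ?S) = m" by (intro cInf_eq_minimum) auto
  then show ?thesis using m unfolding frustration_index_def by auto
qed

end

theory Submission
  imports Defs
begin

text \<open>
  The first eigenvalue is the minimum of the Rayleigh quotient. For the lower bound, test it with
  an optimal phase \<open>\<tau>\<close> on a set \<open>V1\<close>, extended by \<open>0\<close>; since \<open>\<bar>\<tau> u - s u v * \<tau> v\<bar> \<le> 2\<close>, squaring
  an edge term costs at most a factor \<open>2\<close>.

  For the upper bound, let \<open>f\<close> be a normalized Rayleigh minimizer and use \<open>f / \<bar>f\<bar>\<close> as phase on the
  level sets \<open>{t < \<bar>f\<bar>\<^sup>2}\<close>. Integrating the Cheeger inequality of the level sets over \<open>t\<close> gives
  \<open>\<parallel>f\<parallel>\<^sup>2 = 1\<close> on the volume side, and on the other side each edge contributes at most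
  \<open>3/2 * (\<bar>f u\<bar> + \<bar>f v\<bar>) * \<bar>f u - s u v * f v\<bar>\<close>. The Cauchy-Schwarz inequality finishes the proof.
\<close>

section \<open>Edge sums and phases\<close>

text \<open>The endpoints of an edge differ, so exactly two ordered pairs lie over it. This
  translates the frustration, indexed by unoriented edges, into the double sums over vertices used
  elsewhere.\<close>

lemma sum_ordered_pairs_eq_sum_edges:
  fixes g :: "'a set \<Rightarrow> real"
  assumes fin: "finite A" and F: "\<forall>e\<in>F. \<exists>u\<in>A. \<exists>v\<in>A. u \<noteq> v \<and> e = {u, v}"
  shows "(\<Sum>u\<in>A. \<Sum>v\<in>A. if {u, v} \<in> F then g {u, v} else 0) = 2 * (\<Sum>e\<in>F. g e)"
proof -
  define h where "h = (\<lambda>p::'a \<times> 'a. {fst p, snd p})"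
  define P where "P = {p \<in> A \<times> A. h p \<in> F}"
  have finP: "finite P" using fin by (simp add: P_def)
  have "F \<subseteq> Pow A" using F by fastforce
  then have finF: "finite F" using fin by (simp add: finite_subset)
  have "(\<Sum>u\<in>A. \<Sum>v\<in>A. if {u, v} \<in> F then g {u, v} else 0)
      = (\<Sum>p\<in>A \<times> A. if h p \<in> F then g (h p) else 0)"
    unfolding sum.cartesian_product by (intro sum.cong) (auto simp: h_def)
  also have "\<dots> = (\<Sum>p\<in>P. g (h p))"
    unfolding P_def using fin by (simp add: sum.inter_filter)
  also have "\<dots> = (\<Sum>e\<in>F. \<Sum>p\<in>{p \<in> P. h p = e}. g (h p))"
    by (rule sum.group[OF finP finF, symmetric]) (auto simp: P_def h_def)
  also have "\<dots> = (\<Sum>e\<in>F. 2 * g e)"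
  proof (rule sum.cong[OF refl])
    fix e assume e: "e \<in> F"
    then obtain u v where uv: "u \<in> A" "v \<in> A" "u \<noteq> v" "e = {u, v}" using F by blast
    have "{p \<in> P. h p = e} = {(u, v), (v, u)}"
      using uv e by (auto simp: P_def h_def doubleton_eq_iff insert_commute)
    then show "(\<Sum>p\<in>{p \<in> P. h p = e}. g (h p)) = 2 * g e"
      using uv by (simp add: h_def insert_commute)
  qed
  finally show ?thesis by (simp add: sum_distrib_left)
qed

text \<open>Up to scaling, this says that projection to a ball is a contraction.\<close>

lemma norm_sgn_diff_le:
  fixes x y :: "'a::real_inner"
  assumes "norm y \<le> norm x"
  shows "norm y * norm (sgn x - sgn y) \<le> norm (x - y)"
proof (cases "y = 0")
  case False
  define a b c where "a = norm x" and "b = norm y" and "c = sgn x \<bullet> sgn y"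
  have "x \<noteq> 0" using assms False by auto
  then have n: "norm (sgn x) = 1" "norm (sgn y) = 1" using False by (auto simp: norm_sgn)
  have c: "c \<le> 1" using norm_cauchy_schwarz[of "sgn x" "sgn y"] n by (simp add: c_def)
  have ab: "0 \<le> b" "b \<le> a" using assms by (auto simp: a_def b_def)
  have x: "x = a *\<^sub>R sgn x" and y: "y = b *\<^sub>R sgn y"
    by (cases "x = 0"; cases "y = 0"; simp add: a_def b_def sgn_div_norm)+
  have u: "sgn x \<bullet> sgn x = 1" "sgn y \<bullet> sgn y = 1"
    using n by (simp_all add: dot_square_norm)
  have "(norm (x - y))\<^sup>2 = (norm (a *\<^sub>R sgn x - b *\<^sub>R sgn y))\<^sup>2" using x y by simp
  also have "\<dots> = a\<^sup>2 + b\<^sup>2 - 2 * a * b * c"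
    by (simp add: power2_norm_eq_inner inner_diff inner_commute c_def u power2_eq_square[of a]
        power2_eq_square[of b])
  finally have l: "(norm (x - y))\<^sup>2 = a\<^sup>2 + b\<^sup>2 - 2 * a * b * c" .
  have r: "(b * norm (sgn x - sgn y))\<^sup>2 = b\<^sup>2 * (2 - 2 * c)"
    by (simp add: power_mult_distrib power2_norm_eq_inner inner_diff inner_commute c_def u)
  have "b * c \<le> b" using c ab by (simp add: mult_left_le)
  \<comment> \<open>This product is the difference of the two squares \<open>l\<close> and
    \<open>r\<close>; its second factor is nonnegative because
    \<open>b * c \<le> b \<le> a\<close>.\<close>
  then have "0 \<le> (a - b) * (a + b - 2 * (b * c))"
    using ab by (intro mult_nonneg_nonneg) auto
  then have "(b * norm (sgn x - sgn y))\<^sup>2 \<le> (norm (x - y))\<^sup>2"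
    unfolding l r by (simp add: algebra_simps power2_eq_square)
  then show ?thesis unfolding b_def by (rule power2_le_imp_le) simp
qed simp

section \<open>Truncation at a level and integration over the level\<close>

text \<open>The threshold is on the squared modulus, so that integrating the indicators over
  \<open>t\<close> reproduces the density of \<open>mform\<close>. The value \<open>0\<close> off
  the level set lets inner and boundary edges share one expression.\<close>

definition level_phase :: "real \<Rightarrow> complex \<Rightarrow> complex" where
  "level_phase t z = (if t < (cmod z)\<^sup>2 then sgn z else 0)"

lemma has_integral_level_indicator:
  fixes a M :: real
  assumes "0 \<le> a" "a \<le> M"
  shows "((\<lambda>t. if t < a then 1 else 0) has_integral a) {0..M}"
proof -
  have "((\<lambda>t. 1::real) has_integral a) {0..a}"
    using has_integral_const_real[of "1::real" 0 a] assms by simp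
  then have "((\<lambda>t. if t \<in> {0..a} then 1 else 0) has_integral a) {0..M}"
    using assms by (subst has_integral_restrict) auto
  \<comment> \<open>The closed interval and the strict inequality disagree only at
    \<open>t = a\<close>, a null set.\<close>
  then show ?thesis
    by (rule has_integral_spike[OF negligible_sing[of a], rotated]) auto
qed

text \<open>Let \<open>b = cmod y \<le> a = cmod x\<close>. Below \<open>b\<^sup>2\<close> the
  integrand is \<open>cmod (sgn x - sgn y)\<close>, from there up to \<open>a\<^sup>2\<close> it is
  \<open>1\<close>, and then \<open>0\<close>. The first piece contributes at most
  \<open>b * cmod (x - y)\<close>, which is at most half of \<open>(a + b) * cmod (x - y)\<close>;
  the second contributes at most all of it. Hence the constant 3/2.\<close>

lemma level_phase_integral:
  assumes M: "(cmod x)\<^sup>2 \<le> M" "(cmod y)\<^sup>2 \<le> M"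
  shows "(\<lambda>t. cmod (level_phase t x - level_phase t y)) integrable_on {0..M}
    \<and> integral {0..M} (\<lambda>t. cmod (level_phase t x - level_phase t y))
        \<le> 3 / 2 * ((cmod x + cmod y) * cmod (x - y))"
  using M
\<comment> \<open>The claim is symmetric in \<open>x\<close> and \<open>y\<close>, so
  \<open>cmod y \<le> cmod x\<close> may be assumed.\<close>
proof (induction "cmod y" "cmod x" arbitrary: x y rule: linorder_wlog)
  case (le x y)
  define a b c where "a = cmod x" and "b = cmod y" and "c = cmod (sgn x - sgn y)"
  have ab: "0 \<le> b" "b \<le> a" using le by (auto simp: a_def b_def)
  have ab2: "b\<^sup>2 \<le> a\<^sup>2" using ab by (simp add: power_mono)
  have "((\<lambda>t. c * (if t < b\<^sup>2 then 1 else 0) + ((if t < a\<^sup>2 then 1 else 0) - (if t < b\<^sup>2 then 1 else 0)))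
          has_integral c * b\<^sup>2 + (a\<^sup>2 - b\<^sup>2)) {0..M}"
    using le.prems
    by (intro has_integral_add[OF has_integral_mult_right has_integral_diff]
        has_integral_level_indicator) (simp_all add: a_def b_def)
  moreover have "c * (if t < b\<^sup>2 then 1 else 0) + ((if t < a\<^sup>2 then 1 else 0) - (if t < b\<^sup>2 then 1 else 0))
      = cmod (level_phase t x - level_phase t y)" if "t \<in> {0..M}" for t
  proof -
    \<comment> \<open>\<open>sgn x\<close> has modulus 1 only for nonzero \<open>x\<close>; here
      \<open>0 \<le> t\<close> enters.\<close>
    have "x \<noteq> 0" if "t < a\<^sup>2" using that \<open>t \<in> {0..M}\<close> by (auto simp: a_def)
    moreover have "t < a\<^sup>2" if "t < b\<^sup>2" using that ab2 by linarith
    ultimately show ?thesis by (auto simp: level_phase_def a_def b_def c_def norm_sgn)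
  qed
  ultimately have int: "((\<lambda>t. cmod (level_phase t x - level_phase t y))
      has_integral c * b\<^sup>2 + (a\<^sup>2 - b\<^sup>2)) {0..M}"
    by (rule has_integral_eq[rotated])
  define d where "d = cmod (x - y)"
  have d: "b * c \<le> d" "a - b \<le> d" "0 \<le> d"
    using norm_sgn_diff_le[of y x] le.hyps norm_triangle_ineq2[of x y]
    by (auto simp: a_def b_def c_def d_def)
  have "c * b\<^sup>2 \<le> b * d"
    using mult_left_mono[OF d(1) ab(1)] by (simp add: power2_eq_square algebra_simps)
  moreover have "b * d \<le> (a + b) / 2 * d"
    using ab d by (intro mult_right_mono) auto
  moreover have "a\<^sup>2 - b\<^sup>2 \<le> (a + b) * d"
    using mult_left_mono[OF d(2), of "a + b"] ab by (simp add: power2_eq_square algebra_simps)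
  ultimately have "c * b\<^sup>2 + (a\<^sup>2 - b\<^sup>2) \<le> 3 / 2 * ((a + b) * d)"
    by (simp add: field_simps)
  then show ?case
    using has_integral_integrable[OF int] integral_unique[OF int] unfolding a_def b_def d_def by simp
next
  case (sym x y)
  then show ?case by (simp add: norm_minus_commute add.commute)
qed

section \<open>The quadratic forms of a signed graph\<close>

locale signed_graph =
  fixes V :: "'a set" and E :: "'a set set" and w :: "'a \<Rightarrow> 'a \<Rightarrow> real"
    and \<mu> :: "'a \<Rightarrow> real" and s :: "'a \<Rightarrow> 'a \<Rightarrow> complex"
  assumes graph: "simple_graph V E"
    and weight: "edge_weight E w"
    and measure_pos: "\<forall>u\<in>V. 0 < \<mu> u"
    and sig: "signature E s"
begin

lemma finite_V: "finite V" and V_nonempty: "V \<noteq> {}"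
  using graph by (auto simp: simple_graph_def)

text \<open>Extending the weight by \<open>0\<close> off the edges lets all sums run over
  \<open>V \<times> V\<close>, although \<open>w\<close> and \<open>s\<close> are constrained on
  edges only.\<close>

definition adj :: "'a \<Rightarrow> 'a \<Rightarrow> real" where
  "adj u v = (if {u, v} \<in> E then w u v else 0)"

lemma adj_nonneg: "0 \<le> adj u v"
  using weight by (auto simp: adj_def edge_weight_def intro: less_imp_le)

lemma adj_sym: "adj u v = adj v u"
  using weight by (auto simp: adj_def edge_weight_def insert_commute)

lemma norm_signature: "{u, v} \<in> E \<Longrightarrow> cmod (s u v) = 1"
  and signature_swap: "{u, v} \<in> E \<Longrightarrow> s v u = inverse (s u v)"
  using sig by (auto simp: signature_def oriented_edges_def)

text \<open>Vector-valued \<open>f\<close> covers both the complex Laplacian and the real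
  degree.\<close>

lemma sum_adj:
  fixes f :: "'a \<Rightarrow> 'b::real_vector"
  shows "(\<Sum>v\<in>V. adj u v *\<^sub>R f v) = (\<Sum>v | v \<in> V \<and> {u, v} \<in> E. w u v *\<^sub>R f v)"
proof -
  have "(\<Sum>v\<in>V. adj u v *\<^sub>R f v) = (\<Sum>v\<in>V. if {u, v} \<in> E then w u v *\<^sub>R f v else 0)"
    by (intro sum.cong) (auto simp: adj_def)
  then show ?thesis using finite_V by (simp add: sum.inter_filter)
qed

text \<open>The real part of the Hermitian product weighted by \<open>\<mu>\<close>, since
  \<open>\<bullet>\<close> on the complex numbers is the real inner product. Real forms are
  symmetric, and variations need real parameters only.\<close>

definition mform :: "('a \<Rightarrow> complex) \<Rightarrow> ('a \<Rightarrow> complex) \<Rightarrow> real" where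
  "mform f g = (\<Sum>u\<in>V. \<mu> u * (f u \<bullet> g u))"

text \<open>The real part of the Dirichlet form of the Laplacian; the half compensates for counting
  both orientations of each edge.\<close>

definition dform :: "('a \<Rightarrow> complex) \<Rightarrow> ('a \<Rightarrow> complex) \<Rightarrow> real" where
  "dform f g = (\<Sum>u\<in>V. \<Sum>v\<in>V. adj u v * ((f u - s u v * f v) \<bullet> (g u - s u v * g v))) / 2"

abbreviation L where "L \<equiv> laplacian V E w \<mu> s"

lemma mform_self: "mform f f = (\<Sum>u\<in>V. \<mu> u * (cmod (f u))\<^sup>2)"
  by (simp add: mform_def dot_square_norm)

lemma dform_self: "dform f f = (\<Sum>u\<in>V. \<Sum>v\<in>V. adj u v * (cmod (f u - s u v * f v))\<^sup>2) / 2"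
  by (simp add: dform_def dot_square_norm)

lemma mform_nonneg: "0 \<le> mform f f"
  unfolding mform_self using measure_pos by (intro sum_nonneg) (simp add: less_imp_le)

lemma dform_nonneg: "0 \<le> dform f f"
  unfolding dform_self by (simp add: sum_nonneg adj_nonneg)

lemma mform_eq_0_iff: "mform f f = 0 \<longleftrightarrow> (\<forall>u\<in>V. f u = 0)"
proof -
  have "\<forall>u\<in>V. 0 \<le> \<mu> u * (cmod (f u))\<^sup>2" using measure_pos by (simp add: less_imp_le)
  then have "mform f f = 0 \<longleftrightarrow> (\<forall>u\<in>V. \<mu> u * (cmod (f u))\<^sup>2 = 0)"
    unfolding mform_self using finite_V by (intro sum_nonneg_eq_0_iff) auto
  then show ?thesis using measure_pos by fastforce
qed

lemma mform_commute: "mform f g = mform g f"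
  by (simp add: mform_def inner_commute)

lemma dform_commute: "dform f g = dform g f"
  by (simp add: dform_def inner_commute)

lemma mform_add_left: "mform (\<lambda>u. f u + g u) h = mform f h + mform g h"
  by (simp add: mform_def inner_add_left distrib_left sum.distrib)

lemma mform_scale_left: "mform (\<lambda>u. c *\<^sub>R f u) h = c * mform f h"
  by (simp add: mform_def sum_distrib_left mult_ac)

lemma mform_scale: "mform (\<lambda>u. c *\<^sub>R f u) (\<lambda>u. c *\<^sub>R f u) = c\<^sup>2 * mform f f"
  by (simp add: mform_self sum_distrib_left power_mult_distrib mult_ac)

lemma mform_sum_left: "mform (\<lambda>u. \<Sum>i\<in>I. f i u) h = (\<Sum>i\<in>I. mform (f i) h)"
  unfolding mform_def inner_sum_left sum_distrib_left by (rule sum.swap)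

lemma mform_perturb:
  "mform (\<lambda>u. f u + \<epsilon> *\<^sub>R g u) (\<lambda>u. f u + \<epsilon> *\<^sub>R g u)
    = mform f f + 2 * \<epsilon> * mform f g + \<epsilon>\<^sup>2 * mform g g"
  by (simp add: mform_def inner_add inner_commute sum.distrib sum_distrib_left algebra_simps
      power2_eq_square)

lemma dform_perturb:
  "dform (\<lambda>u. f u + \<epsilon> *\<^sub>R g u) (\<lambda>u. f u + \<epsilon> *\<^sub>R g u)
    = dform f f + 2 * \<epsilon> * dform f g + \<epsilon>\<^sup>2 * dform g g"
proof -
  have "(f u + \<epsilon> *\<^sub>R g u) - c * (f v + \<epsilon> *\<^sub>R g v) = (f u - c * f v) + \<epsilon> *\<^sub>R (g u - c * g v)"
    for u v and c :: complex
    by (simp add: algebra_simps)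
  moreover have "(x + \<epsilon> *\<^sub>R y) \<bullet> (x + \<epsilon> *\<^sub>R y) = x \<bullet> x + 2 * \<epsilon> * (x \<bullet> y) + \<epsilon>\<^sup>2 * (y \<bullet> y)"
    for x y :: complex
    by (simp add: inner_add inner_commute power2_eq_square)
  ultimately have "dform (\<lambda>u. f u + \<epsilon> *\<^sub>R g u) (\<lambda>u. f u + \<epsilon> *\<^sub>R g u)
      = (\<Sum>u\<in>V. \<Sum>v\<in>V. adj u v * ((f u - s u v * f v) \<bullet> (f u - s u v * f v))
          + 2 * \<epsilon> * (adj u v * ((f u - s u v * f v) \<bullet> (g u - s u v * g v)))
          + \<epsilon>\<^sup>2 * (adj u v * ((g u - s u v * g v) \<bullet> (g u - s u v * g v)))) / 2"
    unfolding dform_def by (simp only: distrib_left mult.left_commute)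
  then show ?thesis
    by (simp only: dform_def sum.distrib sum_distrib_left[symmetric] add_divide_distrib
        times_divide_eq_right)
qed

lemma dform_scale: "dform (\<lambda>u. c *\<^sub>R f u) (\<lambda>u. c *\<^sub>R f u) = c\<^sup>2 * dform f f"
proof -
  have "c *\<^sub>R x - z * c *\<^sub>R y = c *\<^sub>R (x - z * y)" for x y z :: complex
    by (simp add: algebra_simps)
  then show ?thesis
    by (simp add: dform_self sum_distrib_left power_mult_distrib mult_ac)
qed

text \<open>Summation by parts. Swapping the summation variables and multiplying by the unit number
  \<open>s u v\<close>, which preserves \<open>\<bullet>\<close>, turns the sum \<open>A\<close>
  tested against \<open>g u\<close> into the one tested against \<open>- s u v * g v\<close>. Adding
  both versions gives \<open>2 * dform f g\<close>. As \<open>dform\<close> is symmetric,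
  \<open>L\<close> is self-adjoint.\<close>

lemma green: "mform (L f) g = dform f g"
proof -
  define A where "A = (\<Sum>u\<in>V. \<Sum>v\<in>V. adj u v * ((f u - s u v * f v) \<bullet> g u))"
  have "\<mu> u * (L f u \<bullet> g u) = (\<Sum>v\<in>V. adj u v * ((f u - s u v * f v) \<bullet> g u))" if "u \<in> V" for u
  proof -
    have "L f u = (1 / \<mu> u) *\<^sub>R (\<Sum>v\<in>V. adj u v *\<^sub>R (f u - s u v * f v))"
      unfolding sum_adj by (simp add: laplacian_def scaleR_conv_of_real)
    moreover have "\<mu> u \<noteq> 0" using measure_pos that by auto
    ultimately show ?thesis by (simp add: inner_sum_left)
  qed
  then have A: "mform (L f) g = A" by (simp add: mform_def A_def)
  have "A = (\<Sum>u\<in>V. \<Sum>v\<in>V. adj v u * ((f v - s v u * f u) \<bullet> g v))"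
    unfolding A_def by (rule sum.swap)
  also have "\<dots> = (\<Sum>u\<in>V. \<Sum>v\<in>V. - (adj u v * ((f u - s u v * f v) \<bullet> (s u v * g v))))"
  proof (intro sum.cong refl)
    fix u v
    show "adj v u * ((f v - s v u * f u) \<bullet> g v) = - (adj u v * ((f u - s u v * f v) \<bullet> (s u v * g v)))"
    proof (cases "{u, v} \<in> E")
      case True
      let ?c = "s u v"
      have c: "cmod ?c = 1" and [simp]: "s v u = inverse ?c"
        using True by (simp_all add: norm_signature signature_swap)
      have "?c \<noteq> 0" using c by auto
      then have "f u - ?c * f v = - (?c * (f v - inverse ?c * f u))"
        by (simp add: algebra_simps)
      moreover have "(?c * x) \<bullet> (?c * y) = x \<bullet> y" for x y
      proof -
        have "(?c * x) \<bullet> (?c * y) = ((Re ?c)\<^sup>2 + (Im ?c)\<^sup>2) * (x \<bullet> y)"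
          by (simp add: inner_complex_def power2_eq_square algebra_simps)
        also have "(Re ?c)\<^sup>2 + (Im ?c)\<^sup>2 = 1" using c cmod_power2[of ?c] by simp
        finally show ?thesis by simp
      qed
      ultimately show ?thesis
        by (simp only: \<open>s v u = inverse ?c\<close> inner_minus_left adj_sym[of v u] minus_mult_right minus_minus)
    qed (simp add: adj_def insert_commute)
  qed
  finally have "A + A = (\<Sum>u\<in>V. \<Sum>v\<in>V. adj u v * ((f u - s u v * f v) \<bullet> g u))
      + (\<Sum>u\<in>V. \<Sum>v\<in>V. - (adj u v * ((f u - s u v * f v) \<bullet> (s u v * g v))))"
    by (simp add: A_def)
  also have "\<dots> = 2 * dform f g"
    by (simp add: dform_def inner_diff_right right_diff_distrib sum_subtractf sum_negf)
  finally show ?thesis using A by simp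
qed

section \<open>Eigenvalues and their finiteness\<close>

definition eigenvalues :: "real set" where
  "eigenvalues = {x. is_eigenvalue V L (of_real x)}"

text \<open>The weak form of the eigenvalue equation, with a normalized eigenfunction. The operator
  no longer appears, so orthogonality and comparison with the Rayleigh minimum become statements
  about the two forms.\<close>

lemma eigenvalueE:
  assumes "x \<in> eigenvalues"
  obtains f where "mform f f = 1" "\<And>g. dform f g = x * mform f g"
proof -
  obtain f where f: "\<exists>u\<in>V. f u \<noteq> 0" "\<forall>u\<in>V. L f u = of_real x * f u"
    using assms by (auto simp: eigenvalues_def is_eigenvalue_def)
  have ev: "dform f g = x * mform f g" for g
    unfolding green[symmetric] mform_scale_left[symmetric]
    unfolding mform_def using f(2) by (intro sum.cong) (auto simp: scaleR_conv_of_real)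
  have "0 < mform f f"
    using mform_nonneg[of f] mform_eq_0_iff[of f] f(1) by fastforce
  define c where "c = 1 / sqrt (mform f f)"
  have "mform (\<lambda>u. c *\<^sub>R f u) (\<lambda>u. c *\<^sub>R f u) = c\<^sup>2 * mform f f"
    by (rule mform_scale)
  also have "\<dots> = 1" using \<open>0 < mform f f\<close> by (simp add: c_def power_divide)
  finally have "mform (\<lambda>u. c *\<^sub>R f u) (\<lambda>u. c *\<^sub>R f u) = 1" .
  moreover have "dform (\<lambda>u. c *\<^sub>R f u) g = x * mform (\<lambda>u. c *\<^sub>R f u) g" for g
  proof -
    have "L (\<lambda>u. c *\<^sub>R f u) u = c *\<^sub>R L f u" for u
      by (simp add: laplacian_def scaleR_conv_of_real sum_distrib_left algebra_simps)
    then have "dform (\<lambda>u. c *\<^sub>R f u) g = mform (\<lambda>u. c *\<^sub>R L f u) g"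
      unfolding green[symmetric] by (intro arg_cong2[of _ _ _ _ mform] ext refl)
    then show ?thesis by (simp add: mform_scale_left green ev)
  qed
  ultimately show thesis by (rule that)
qed

text \<open>With \<open>p\<close> the orthogonal projection of \<open>h\<close> to the span of the
  \<open>g i\<close>, this is the nonnegativity of the squared norm of \<open>h - p\<close>; both
  \<open>mform h p\<close> and \<open>mform p p\<close> equal the sum on the left.\<close>

lemma bessel:
  assumes "finite I" and on: "\<And>i j. i \<in> I \<Longrightarrow> j \<in> I \<Longrightarrow> mform (g i) (g j) = (if i = j then 1 else 0)"
  shows "(\<Sum>i\<in>I. (mform h (g i))\<^sup>2) \<le> mform h h"
proof -
  define p where "p = (\<lambda>u. \<Sum>i\<in>I. mform h (g i) *\<^sub>R g i u)"
  have p: "mform p f = (\<Sum>i\<in>I. mform h (g i) * mform (g i) f)" for f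
    by (simp add: p_def mform_sum_left mform_scale_left)
  have "mform p (g j) = mform h (g j)" if "j \<in> I" for j
  proof -
    have "mform p (g j) = (\<Sum>i\<in>I. if i = j then mform h (g i) else 0)"
      unfolding p using on that by (intro sum.cong) auto
    then show ?thesis using assms(1) that by simp
  qed
  then have "mform (g j) p = mform h (g j)" if "j \<in> I" for j
    using that by (subst mform_commute)
  then have pp: "mform p p = (\<Sum>i\<in>I. (mform h (g i))\<^sup>2)"
    by (simp add: p power2_eq_square)
  have hp: "mform h p = (\<Sum>i\<in>I. (mform h (g i))\<^sup>2)"
    by (simp add: mform_commute[of h p] p mform_commute[of "g _" h] power2_eq_square)
  have "0 \<le> mform h h + 2 * (-1) * mform h p + (-1)\<^sup>2 * mform p p"
    unfolding mform_perturb[symmetric] by (rule mform_nonneg)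
  then show ?thesis using pp hp by simp
qed

text \<open>The bound is the real dimension: Bessel's inequality is applied to the point masses
  with values \<open>1\<close> and \<open>\<i>\<close>.\<close>

lemma card_orthonormal_le:
  assumes "finite I" and on: "\<And>i j. i \<in> I \<Longrightarrow> j \<in> I \<Longrightarrow> mform (g i) (g j) = (if i = j then 1 else 0)"
  shows "card I \<le> 2 * card V"
proof -
  have pt: "(\<Sum>i\<in>I. \<mu> u * (g i u \<bullet> b)\<^sup>2) \<le> (cmod b)\<^sup>2" if u: "u \<in> V" for u b
  proof -
    define h where "h = (\<lambda>v. if v = u then b else 0)"
    have pos: "0 < \<mu> u" using measure_pos u by auto
    have hf: "mform h f = \<mu> u * (f u \<bullet> b)" for f
    proof -
      have "mform h f = (\<Sum>v\<in>V. if v = u then \<mu> v * (f v \<bullet> b) else 0)"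
        unfolding mform_def h_def by (intro sum.cong) (auto simp: inner_commute)
      then show ?thesis using finite_V u by simp
    qed
    have "(\<Sum>i\<in>I. (\<mu> u * (g i u \<bullet> b))\<^sup>2) \<le> \<mu> u * (cmod b)\<^sup>2"
      using bessel[OF assms, of h] unfolding hf by (simp add: h_def dot_square_norm)
    moreover have "(\<Sum>i\<in>I. (\<mu> u * (g i u \<bullet> b))\<^sup>2) = \<mu> u * (\<Sum>i\<in>I. \<mu> u * (g i u \<bullet> b)\<^sup>2)"
      by (simp add: sum_distrib_left power2_eq_square mult_ac)
    ultimately show ?thesis using pos by simp
  qed
  \<comment> \<open>The products with \<open>1\<close> and \<open>\<i>\<close> are the real and
    imaginary parts. After exchanging the sums, each vertex contributes at most 1 for either of
    them.\<close>
  have "real (card I) = (\<Sum>i\<in>I. mform (g i) (g i))" using on by simp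
  also have "\<dots> = (\<Sum>i\<in>I. \<Sum>u\<in>V. \<mu> u * (g i u \<bullet> 1)\<^sup>2 + \<mu> u * (g i u \<bullet> \<i>)\<^sup>2)"
    by (simp add: mform_self cmod_power2 inner_complex_def distrib_left)
  also have "\<dots> = (\<Sum>u\<in>V. \<Sum>i\<in>I. \<mu> u * (g i u \<bullet> 1)\<^sup>2 + \<mu> u * (g i u \<bullet> \<i>)\<^sup>2)"
    by (rule sum.swap)
  also have "\<dots> = (\<Sum>u\<in>V. (\<Sum>i\<in>I. \<mu> u * (g i u \<bullet> 1)\<^sup>2) + (\<Sum>i\<in>I. \<mu> u * (g i u \<bullet> \<i>)\<^sup>2))"
    by (simp add: sum.distrib)
  also have "\<dots> \<le> (\<Sum>u\<in>V. (cmod 1)\<^sup>2 + (cmod \<i>)\<^sup>2)"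
    by (intro sum_mono add_mono pt)
  also have "\<dots> = real (2 * card V)" by simp
  finally show ?thesis by (simp only: of_nat_le_iff)
qed

text \<open>Needed for \<open>Min\<close> in \<open>lambda1\<close> to be meaningful.\<close>

lemma finite_eigenvalues: "finite eigenvalues"
proof (rule ccontr)
  assume "infinite eigenvalues"
  \<comment> \<open>One eigenvalue more than the real dimension allows: normalized eigenfunctions
    for distinct eigenvalues are orthogonal because \<open>dform\<close> is symmetric.\<close>
  then obtain I where I: "I \<subseteq> eigenvalues" "finite I" "card I = Suc (2 * card V)"
    by (meson infinite_arbitrarily_large)
  have "\<forall>x\<in>eigenvalues. \<exists>f. mform f f = 1 \<and> (\<forall>h. dform f h = x * mform f h)"
    by (metis eigenvalueE)
  then obtain g where g: "\<forall>x\<in>eigenvalues. mform (g x) (g x) = 1 \<and> (\<forall>h. dform (g x) h = x * mform (g x) h)"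
    by metis
  have "mform (g x) (g y) = (if x = y then 1 else 0)" if "x \<in> I" "y \<in> I" for x y
  proof (cases "x = y")
    case False
    have xy: "x \<in> eigenvalues" "y \<in> eigenvalues" using that I by auto
    have "x * mform (g x) (g y) = dform (g x) (g y)" using g xy(1) by simp
    also have "\<dots> = dform (g y) (g x)" by (rule dform_commute)
    also have "\<dots> = y * mform (g y) (g x)" using g xy(2) by simp
    finally have "(x - y) * mform (g x) (g y) = 0"
      by (simp add: mform_commute[of "g y"] left_diff_distrib)
    then show ?thesis using False by simp
  qed (use that g I in auto)
  then have "card I \<le> 2 * card V" by (rule card_orthonormal_le[OF I(2)])
  then show False using I(3) by simp
qed

section \<open>The first eigenvalue as a Rayleigh minimum\<close>

text \<open>A continuous function attains its minimum on the compact unit sphere \<open>S\<close> of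
  \<open>mform\<close>. Homogeneity carries the bound over to every \<open>g\<close> of positive
  norm; for norm zero it is \<open>dform_nonneg\<close>.\<close>

lemma rayleigh_minimizer:
  obtains f where "mform f f = 1" "\<And>g. dform f f * mform g g \<le> dform g g"
proof -
  let ?X = "product_topology (\<lambda>_. euclidean) V :: ('a \<Rightarrow> complex) topology"
  \<comment> \<open>A unit vector satisfies \<open>\<mu> u * (cmod (f u))\<^sup>2 \<le> 1\<close>,
    whence the radius. A product of discs is compact, so \<open>S\<close> is compact as soon as it
    is closed in it.\<close>
  define B where "B = (\<Pi>\<^sub>E u\<in>V. cball (0::complex) (1 / sqrt (\<mu> u)))"
  define S where "S = {f \<in> topspace ?X. mform f f \<in> {1}} \<inter> B"
  have pr: "continuous_map ?X euclidean (\<lambda>f. f u)" if "u \<in> V" for u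
    using continuous_map_product_projection[OF that, of "\<lambda>_. euclidean"] by simp
  have cm: "continuous_map ?X euclideanreal (\<lambda>f. mform f f)"
    unfolding mform_self
    by (intro continuous_map_sum continuous_map_real_mult_left continuous_map_real_pow
        continuous_map_norm pr finite_V)
  have pr': "continuous_map ?X euclidean (\<lambda>f. c * f v)" if "v \<in> V" for v c
    using continuous_map_compose[OF pr[OF that], of euclidean "(*) c"]
    by (simp add: o_def continuous_map_iff_continuous2 continuous_intros)
  have cd: "continuous_map ?X euclideanreal (\<lambda>f. dform f f)"
    unfolding dform_self
    by (intro continuous_map_sum continuous_map_real_mult_left continuous_map_real_pow
        continuous_map_norm continuous_map_diff pr pr' finite_V continuous_map_real_divide) auto
  have "compactin ?X B" unfolding B_def by (simp add: compactin_PiE)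
  then have comp: "compactin ?X S"
    unfolding S_def by (intro closed_Int_compactin closedin_continuous_map_preimage[OF cm]) auto
  have normalize: "\<exists>f\<in>S. dform g g = mform g g * dform f f" if g: "mform g g > 0" for g
  proof -
    define c where "c = 1 / sqrt (mform g g)"
    \<comment> \<open>Points of the product space are extensional, so the scaled function is
      restricted to \<open>V\<close>; the forms see only values on \<open>V\<close>.\<close>
    define f where "f = restrict (\<lambda>u. c *\<^sub>R g u) V"
    have "mform f f = mform (\<lambda>u. c *\<^sub>R g u) (\<lambda>u. c *\<^sub>R g u)"
      unfolding mform_def by (intro sum.cong refl) (simp add: f_def)
    also have "\<dots> = c\<^sup>2 * mform g g"
      by (rule mform_scale)
    finally have f1: "mform f f = 1" using g by (simp add: c_def power_divide)
    have "cmod (f u) \<le> 1 / sqrt (\<mu> u)" if u: "u \<in> V" for u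
    proof -
      have pos: "0 < \<mu> u" using measure_pos u by auto
      have "\<mu> u * (cmod (f u))\<^sup>2 \<le> mform f f"
        unfolding mform_self
        by (rule member_le_sum[OF u]) (use measure_pos finite_V in \<open>auto simp: less_imp_le\<close>)
      then have "(cmod (f u))\<^sup>2 \<le> (1 / sqrt (\<mu> u))\<^sup>2"
        using f1 pos by (simp add: field_simps)
      then show ?thesis by (rule power2_le_imp_le) (use pos in auto)
    qed
    then have "f \<in> S" using f1 by (auto simp: S_def B_def f_def PiE_iff)
    moreover have "dform f f = dform (\<lambda>u. c *\<^sub>R g u) (\<lambda>u. c *\<^sub>R g u)"
      unfolding dform_def by (intro sum.cong refl arg_cong2[of _ _ _ _ "(/)"]) (simp add: f_def)
    then have "dform f f = c\<^sup>2 * dform g g" by (simp add: dform_scale)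
    then have "dform g g = mform g g * dform f f" using g by (simp add: c_def power_divide)
    ultimately show ?thesis by blast
  qed
  have "mform (\<lambda>_. 1) (\<lambda>_. 1) \<noteq> 0" using mform_eq_0_iff[of "\<lambda>_. 1"] V_nonempty by auto
  then have "mform (\<lambda>_. 1) (\<lambda>_. 1) > 0" using mform_nonneg[of "\<lambda>_. 1"] by simp
  then have "S \<noteq> {}" using normalize by blast
  moreover have "compact ((\<lambda>f. dform f f) ` S)" using image_compactin[OF comp cd] by simp
  ultimately obtain f where f: "f \<in> S" "\<And>g. g \<in> S \<Longrightarrow> dform f f \<le> dform g g"
    using compact_attains_inf[of "(\<lambda>f. dform f f) ` S"] by auto
  have "dform f f * mform g g \<le> dform g g" for g
  proof (cases "mform g g > 0")
    case True
    then obtain k where k: "k \<in> S" "dform g g = mform g g * dform k k" using normalize by blast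
    then show ?thesis using f(2)[OF k(1)] True by (simp add: mult.commute)
  next
    case False
    then have "mform g g = 0" using mform_nonneg[of g] by simp
    then show ?thesis using dform_nonneg[of g] by simp
  qed
  moreover have "mform f f = 1" using f(1) by (simp add: S_def)
  ultimately show thesis using that by blast
qed

text \<open>A Rayleigh minimizer is an eigenfunction, so its quotient \<open>l\<close> is an
  eigenvalue. Every eigenvalue is the Rayleigh quotient of its eigenfunction, so none is
  smaller.\<close>

lemma lambda1_minimizer:
  obtains f where "mform f f = 1" "dform f f = lambda1 V E w \<mu> s"
    "\<And>g. lambda1 V E w \<mu> s * mform g g \<le> dform g g"
proof -
  obtain f where f: "mform f f = 1" "\<And>g. dform f f * mform g g \<le> dform g g"
    using rayleigh_minimizer by blast
  define l where "l = dform f f"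
  \<comment> \<open>Perturbing the minimizer in the direction of its own residual forces the residual to vanish.\<close>
  define r where "r = (\<lambda>u. L f u + (- l) *\<^sub>R f u)"
  have rr: "mform r r = dform f r - l * mform f r"
    by (subst r_def) (simp only: mform_add_left mform_scale_left green mult_minus_left diff_conv_add_uminus)
  \<comment> \<open>The Rayleigh inequality at \<open>f + \<epsilon> r\<close>. The terms of order 0
    cancel, and by \<open>rr\<close> the first variation is \<open>mform r r\<close>.\<close>
  have q: "0 \<le> 2 * \<epsilon> * mform r r + \<epsilon>\<^sup>2 * (dform r r - l * mform r r)" for \<epsilon>
    using f(2)[of "\<lambda>u. f u + \<epsilon> *\<^sub>R r u"] f(1) unfolding mform_perturb dform_perturb rr l_def
    by (simp add: algebra_simps)
  have "mform r r = 0"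
  proof (rule ccontr)
    assume "mform r r \<noteq> 0"
    then have a: "0 < mform r r" using mform_nonneg[of r] by simp
    define k where "k = dform r r - l * mform r r"
    have k: "0 \<le> k" using f(2)[of r] by (simp add: k_def l_def)
    \<comment> \<open>A step so small that the quadratic term cannot make up for the linear
      decrease; adding 1 keeps the denominator positive when \<open>k = 0\<close>.\<close>
    define e where "e = mform r r / (k + 1)"
    have e: "0 < e" "e * k < mform r r" using a k by (auto simp: e_def field_simps)
    have "0 \<le> 2 * (- e) * mform r r + (- e)\<^sup>2 * k" using q[of "- e"] by (simp add: k_def)
    also have "\<dots> = e * (e * k - 2 * mform r r)" by (simp add: power2_eq_square algebra_simps)
    finally have "0 \<le> e * k - 2 * mform r r" using e(1) by (simp add: zero_le_mult_iff)
    then show False using e a by simp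
  qed
  then have "\<forall>u\<in>V. L f u = of_real l * f u"
    by (simp add: mform_eq_0_iff r_def scaleR_conv_of_real)
  moreover have "\<exists>u\<in>V. f u \<noteq> 0" using f(1) mform_eq_0_iff[of f] by auto
  ultimately have "l \<in> eigenvalues" by (auto simp: eigenvalues_def is_eigenvalue_def)
  moreover have "l \<le> x" if "x \<in> eigenvalues" for x
    using eigenvalueE[OF that] f(2) by (metis l_def mult.right_neutral)
  ultimately have "Min eigenvalues = l" by (intro Min_eqI finite_eigenvalues)
  then have "lambda1 V E w \<mu> s = l" by (simp add: lambda1_def eigenvalues_def)
  then show thesis using that f by (simp add: l_def)
qed

section \<open>Cheeger ratios as edge sums, and the lower bound\<close>

text \<open>Pairs inside \<open>V1\<close> give the frustration twice. Pairs with one end in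
  \<open>V1\<close> have an edge term of modulus 1 and give the boundary once in each order. Pairs
  outside give 0. Thus one function \<open>g\<close> encodes both the set and its phase.\<close>

lemma frustration_plus_boundary:
  assumes V1: "V1 \<subseteq> V" and g1: "\<And>u. u \<in> V1 \<Longrightarrow> cmod (g u) = 1"
    and g0: "\<And>u. u \<in> V - V1 \<Longrightarrow> g u = 0"
  shows "frustration E w s V1 g + boundary_weight V E w V1
    = (\<Sum>u\<in>V. \<Sum>v\<in>V. adj u v * cmod (g u - s u v * g v)) / 2"
proof -
  define c where "c = (\<lambda>u v. adj u v * cmod (g u - s u v * g v))"
  have fin1: "finite V1" using V1 finite_V finite_subset by blast
  have edges: "\<forall>e\<in>induced_edges E V1. \<exists>u\<in>V1. \<exists>v\<in>V1. u \<noteq> v \<and> e = {u, v}"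
    using graph unfolding simple_graph_def induced_edges_def by fastforce
  have "2 * frustration E w s V1 g
      = (\<Sum>u\<in>V1. \<Sum>v\<in>V1. if {u, v} \<in> induced_edges E V1 then edge_frustration w s g {u, v} else 0)"
    unfolding frustration_def sum_ordered_pairs_eq_sum_edges[OF fin1 edges] ..
  also have "\<dots> = (\<Sum>u\<in>V1. \<Sum>v\<in>V1. c u v)"
    by (intro sum.cong refl)
      (auto simp: induced_edges_def c_def adj_def edge_frustration_eq[OF weight sig])
  finally have inner: "2 * frustration E w s V1 g = (\<Sum>u\<in>V1. \<Sum>v\<in>V1. c u v)" .
  have fin2: "finite (V - V1)" using finite_V by simp
  have b1: "boundary_weight V E w V1 = (\<Sum>u\<in>V1. \<Sum>v\<in>V - V1. c u v)"
    unfolding boundary_weight_def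
  proof (rule sum.cong[OF refl])
    fix u assume u: "u \<in> V1"
    have "(\<Sum>v | v \<in> V - V1 \<and> {u, v} \<in> E. w u v) = (\<Sum>v\<in>V - V1. if {u, v} \<in> E then w u v else 0)"
      using fin2 by (rule sum.inter_filter)
    also have "\<dots> = (\<Sum>v\<in>V - V1. c u v)"
      using g1[OF u] g0 by (intro sum.cong refl) (auto simp: c_def adj_def)
    finally show "(\<Sum>v | v \<in> V - V1 \<and> {u, v} \<in> E. w u v) = (\<Sum>v\<in>V - V1. c u v)" .
  qed
  have c_sym: "c u v = c v u" if "u \<in> V1" "v \<in> V - V1" for u v
  proof (cases "{u, v} \<in> E")
    case True
    then have "{v, u} \<in> E" by (simp add: insert_commute)
    then show ?thesis
      using g1[OF that(1)] g0[OF that(2)] True by (simp add: c_def norm_mult norm_signature adj_sym)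
  qed (simp add: c_def adj_def insert_commute)
  have b2: "boundary_weight V E w V1 = (\<Sum>u\<in>V - V1. \<Sum>v\<in>V1. c u v)"
    unfolding b1 by (subst sum.swap) (intro sum.cong refl c_sym)
  have zero: "(\<Sum>u\<in>V - V1. \<Sum>v\<in>V - V1. c u v) = 0" using g0 by (simp add: c_def)
  have split: "(\<Sum>v\<in>V. h v) = (\<Sum>v\<in>V1. h v) + (\<Sum>v\<in>V - V1. h v)" for h :: "'a \<Rightarrow> real"
    using sum.subset_diff[OF V1 finite_V, of h] by simp
  have "(\<Sum>u\<in>V. \<Sum>v\<in>V. c u v) = (\<Sum>u\<in>V1. \<Sum>v\<in>V. c u v) + (\<Sum>u\<in>V - V1. \<Sum>v\<in>V. c u v)"
    by (rule split)
  also have "\<dots> = 2 * (frustration E w s V1 g + boundary_weight V E w V1)"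
    unfolding split[of "c _"] sum.distrib using inner b1 b2 zero by simp
  finally show ?thesis by (simp add: c_def)
qed

text \<open>Only edges inside \<open>V1\<close> enter. This reconciles phases extended by
  \<open>0\<close> with the extensional functions over which \<open>frustration_index\<close> is
  taken.\<close>

lemma frustration_cong:
  assumes "\<And>u. u \<in> V1 \<Longrightarrow> f u = g u"
  shows "frustration E w s V1 f = frustration E w s V1 g"
  unfolding frustration_def
proof (rule sum.cong[OF refl])
  fix e assume "e \<in> induced_edges E V1"
  then obtain u v where "e = {u, v}" "{u, v} \<in> E" "u \<in> V1" "v \<in> V1"
    using graph unfolding simple_graph_def induced_edges_def by fastforce
  then show "edge_frustration w s f e = edge_frustration w s g e"
    by (simp add: edge_frustration_eq[OF weight sig] assms)
qed

lemma frustration_index_le: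
  assumes "V1 \<subseteq> V" "\<And>u. u \<in> V1 \<Longrightarrow> cmod (g u) = 1"
  shows "frustration_index E w s V1 \<le> frustration E w s V1 g"
proof -
  have "restrict g V1 \<in> V1 \<rightarrow>\<^sub>E sphere 0 1" using assms(2) by auto
  then have "frustration_index E w s V1 \<le> frustration E w s V1 (restrict g V1)"
    using frustration_index_attained[OF graph weight sig assms(1)] by auto
  also have "\<dots> = frustration E w s V1 g" by (rule frustration_cong) simp
  finally show ?thesis .
qed

lemma volume_pos: "V1 \<subseteq> V \<Longrightarrow> V1 \<noteq> {} \<Longrightarrow> 0 < volume \<mu> V1"
  unfolding volume_def using finite_V measure_pos finite_subset by (intro sum_pos) auto

lemma finite_cheeger_ratios: "finite (cheeger_ratio V E w \<mu> s ` {V1. V1 \<noteq> {} \<and> V1 \<subseteq> V})"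
  using finite_V by simp

text \<open>Clearing the denominator keeps the bound true for empty \<open>V1\<close>, as happens
  for high level sets. The minimum over phases is replaced by a given \<open>g\<close>, so that the
  right side can be integrated.\<close>

lemma cheeger_constant_mult_volume_le:
  assumes V1: "V1 \<subseteq> V" and g1: "\<And>u. u \<in> V1 \<Longrightarrow> cmod (g u) = 1"
    and g0: "\<And>u. u \<in> V - V1 \<Longrightarrow> g u = 0"
  shows "cheeger_constant V E w \<mu> s * volume \<mu> V1
    \<le> (\<Sum>u\<in>V. \<Sum>v\<in>V. adj u v * cmod (g u - s u v * g v)) / 2"
proof (cases "V1 = {}")
  case True
  then show ?thesis by (simp add: volume_def sum_nonneg adj_nonneg)
next
  case False
  then have "cheeger_constant V E w \<mu> s \<le> cheeger_ratio V E w \<mu> s V1"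
    unfolding cheeger_constant_def using V1 by (intro Min_le finite_cheeger_ratios) auto
  then have "cheeger_constant V E w \<mu> s * volume \<mu> V1
      \<le> frustration_index E w s V1 + boundary_weight V E w V1"
    using volume_pos[OF V1 False] by (simp add: cheeger_ratio_def pos_le_divide_eq)
  also have "\<dots> \<le> frustration E w s V1 g + boundary_weight V E w V1"
    using frustration_index_le[OF V1] g1 by simp
  finally show ?thesis using frustration_plus_boundary[of V1 g, OF assms] by linarith
qed

text \<open>For each \<open>V1\<close>, the test function has \<open>dform g g\<close> at most twice
  the numerator of the Cheeger ratio and \<open>mform g g\<close> equal to its denominator.\<close>

lemma cheeger_lower: "1 / 2 * lambda1 V E w \<mu> s \<le> cheeger_constant V E w \<mu> s"
  unfolding cheeger_constant_def
proof (rule Min.boundedI[OF finite_cheeger_ratios])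
  show "cheeger_ratio V E w \<mu> s ` {V1. V1 \<noteq> {} \<and> V1 \<subseteq> V} \<noteq> {}" using V_nonempty by blast
  fix x assume "x \<in> cheeger_ratio V E w \<mu> s ` {V1. V1 \<noteq> {} \<and> V1 \<subseteq> V}"
  then obtain V1 where V1: "V1 \<noteq> {}" "V1 \<subseteq> V" and x: "x = cheeger_ratio V E w \<mu> s V1" by auto
  obtain \<tau> where \<tau>: "\<tau> \<in> V1 \<rightarrow>\<^sub>E sphere 0 1" "frustration_index E w s V1 = frustration E w s V1 \<tau>"
    using frustration_index_attained[OF graph weight sig V1(2)] by blast
  define g where "g = (\<lambda>u. if u \<in> V1 then \<tau> u else 0)"
  have g1: "cmod (g u) = 1" if "u \<in> V1" for u using \<tau>(1) that by (auto simp: g_def)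
  have g0: "g u = 0" if "u \<in> V - V1" for u using that by (simp add: g_def)
  have gle: "cmod (g u) \<le> 1" for u using g1 by (cases "u \<in> V1") (auto simp: g_def)
  have "dform g g \<le> (\<Sum>u\<in>V. \<Sum>v\<in>V. 2 * (adj u v * cmod (g u - s u v * g v))) / 2"
    unfolding dform_self
  proof (intro divide_right_mono sum_mono)
    fix u v
    show "adj u v * (cmod (g u - s u v * g v))\<^sup>2 \<le> 2 * (adj u v * cmod (g u - s u v * g v))"
    proof (cases "{u, v} \<in> E")
      case True
      have "cmod (g u - s u v * g v) \<le> cmod (g u) + cmod (s u v * g v)" by (rule norm_triangle_ineq4)
      also have "\<dots> \<le> 2" using gle[of u] gle[of v] True by (simp add: norm_mult norm_signature)
      finally have "(cmod (g u - s u v * g v))\<^sup>2 \<le> 2 * cmod (g u - s u v * g v)"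
        by (simp add: power2_eq_square mult_right_mono)
      then show ?thesis using mult_left_mono[OF _ adj_nonneg] by (fastforce simp: mult.left_commute)
    qed (simp add: adj_def)
  qed simp
  also have "\<dots> = 2 * (frustration E w s V1 g + boundary_weight V E w V1)"
    using frustration_plus_boundary[of V1 g, OF V1(2) g1 g0]
    by (simp add: sum_distrib_left[symmetric])
  also have "frustration E w s V1 g = frustration_index E w s V1"
    unfolding \<tau>(2) by (rule frustration_cong) (simp add: g_def)
  finally have D: "dform g g \<le> 2 * (frustration_index E w s V1 + boundary_weight V E w V1)" .
  have "mform g g = (\<Sum>u\<in>V1. \<mu> u * (cmod (g u))\<^sup>2)"
    unfolding mform_self using V1 finite_V g0 by (intro sum.mono_neutral_right) auto
  then have N: "mform g g = volume \<mu> V1" using g1 by (simp add: volume_def)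
  have "lambda1 V E w \<mu> s * mform g g \<le> dform g g" using lambda1_minimizer by metis
  then have "1 / 2 * lambda1 V E w \<mu> s * volume \<mu> V1
      \<le> frustration_index E w s V1 + boundary_weight V E w V1"
    using D N by simp
  then show "1 / 2 * lambda1 V E w \<mu> s \<le> x"
    unfolding x cheeger_ratio_def using volume_pos[OF V1(2,1)] by (simp add: pos_le_divide_eq)
qed

section \<open>The upper bound\<close>

text \<open>After \<open>(x + y)\<^sup>2 \<le> 2 * x\<^sup>2 + 2 * y\<^sup>2\<close>, symmetry of
  \<open>adj\<close> makes both halves equal. Each is a sum of weighted degrees against
  \<open>(cmod (f u))\<^sup>2\<close>; this is how the maximal degree enters.\<close>

lemma sum_adj_norm_add_le:
  "(\<Sum>u\<in>V. \<Sum>v\<in>V. adj u v * (cmod (f u) + cmod (f v))\<^sup>2) \<le> 4 * (max_degree V E w \<mu> * mform f f)"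
proof -
  define A where "A = (\<Sum>u\<in>V. \<Sum>v\<in>V. adj u v * (cmod (f u))\<^sup>2)"
  have swap: "(\<Sum>u\<in>V. \<Sum>v\<in>V. adj u v * (cmod (f v))\<^sup>2) = A"
    unfolding A_def by (subst sum.swap) (simp add: adj_sym)
  have "(x + y)\<^sup>2 \<le> 2 * x\<^sup>2 + 2 * y\<^sup>2" for x y :: real
    using zero_le_power2[of "x - y"] by (simp add: power2_eq_square algebra_simps)
  then have "(\<Sum>u\<in>V. \<Sum>v\<in>V. adj u v * (cmod (f u) + cmod (f v))\<^sup>2)
      \<le> (\<Sum>u\<in>V. \<Sum>v\<in>V. adj u v * (2 * (cmod (f u))\<^sup>2 + 2 * (cmod (f v))\<^sup>2))"
    by (intro sum_mono mult_left_mono adj_nonneg)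
  also have "\<dots> = 2 * A + 2 * A"
    unfolding distrib_left sum.distrib mult.left_commute[of _ 2] sum_distrib_left[symmetric] swap
    by (simp add: A_def)
  also have "A \<le> max_degree V E w \<mu> * mform f f"
    unfolding A_def mform_self sum_distrib_left[of "max_degree V E w \<mu>"]
  proof (rule sum_mono)
    fix u assume u: "u \<in> V"
    have pos: "0 < \<mu> u" using measure_pos u by auto
    have "(\<Sum>v\<in>V. adj u v * (cmod (f u))\<^sup>2) = wdegree V E w u * (cmod (f u))\<^sup>2"
      using sum_adj[of u "\<lambda>_. 1 :: real"] by (simp add: wdegree_def sum_distrib_right[symmetric])
    moreover have "wdegree V E w u / \<mu> u \<le> max_degree V E w \<mu>"
      unfolding max_degree_def using finite_V u by (intro Max_ge) auto
    then have "wdegree V E w u \<le> max_degree V E w \<mu> * \<mu> u" using pos by (simp add: pos_divide_le_eq)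
    then have "wdegree V E w u * (cmod (f u))\<^sup>2 \<le> max_degree V E w \<mu> * \<mu> u * (cmod (f u))\<^sup>2"
      by (intro mult_right_mono) auto
    ultimately show "(\<Sum>v\<in>V. adj u v * (cmod (f u))\<^sup>2)
        \<le> max_degree V E w \<mu> * (\<mu> u * (cmod (f u))\<^sup>2)"
      by (simp add: mult.assoc)
  qed
  finally show ?thesis by simp
qed

text \<open>Splitting \<open>adj u v\<close> into two square roots reduces this to the inequality
  for \<open>L2_set\<close> over \<open>V \<times> V\<close>.\<close>

lemma weighted_cauchy_schwarz:
  fixes a b :: "'a \<Rightarrow> 'a \<Rightarrow> real"
  shows "(\<Sum>u\<in>V. \<Sum>v\<in>V. adj u v * (a u v * b u v))
    \<le> sqrt (\<Sum>u\<in>V. \<Sum>v\<in>V. adj u v * (a u v)\<^sup>2) * sqrt (\<Sum>u\<in>V. \<Sum>v\<in>V. adj u v * (b u v)\<^sup>2)"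
proof -
  let ?f = "\<lambda>(u, v). sqrt (adj u v) * a u v" and ?g = "\<lambda>(u, v). sqrt (adj u v) * b u v"
  have "(\<Sum>u\<in>V. \<Sum>v\<in>V. adj u v * (a u v * b u v)) = (\<Sum>p\<in>V \<times> V. ?f p * ?g p)"
    unfolding sum.cartesian_product
    by (intro sum.cong refl) (auto simp: adj_nonneg algebra_simps)
  also have "\<dots> \<le> (\<Sum>p\<in>V \<times> V. \<bar>?f p\<bar> * \<bar>?g p\<bar>)"
    by (intro sum_mono) (simp add: abs_mult[symmetric])
  also have "\<dots> \<le> L2_set ?f (V \<times> V) * L2_set ?g (V \<times> V)"
    by (rule L2_set_mult_ineq)
  also have "\<dots> = sqrt (\<Sum>u\<in>V. \<Sum>v\<in>V. adj u v * (a u v)\<^sup>2) * sqrt (\<Sum>u\<in>V. \<Sum>v\<in>V. adj u v * (b u v)\<^sup>2)"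
    unfolding L2_set_def sum.cartesian_product
    by (simp add: case_prod_unfold power_mult_distrib adj_nonneg)
  finally show ?thesis .
qed

lemma cheeger_upper:
  "cheeger_constant V E w \<mu> s \<le> 3 / 2 * sqrt (2 * max_degree V E w \<mu> * lambda1 V E w \<mu> s)"
proof -
  obtain f where f: "mform f f = 1" "dform f f = lambda1 V E w \<mu> s" using lambda1_minimizer by metis
  define h where "h = cheeger_constant V E w \<mu> s"
  \<comment> \<open>A common bound for all squared moduli, so that \<open>{0..M}\<close> contains
    every relevant level.\<close>
  define M where "M = (\<Sum>u\<in>V. (cmod (f u))\<^sup>2)"
  have M: "(cmod (f u))\<^sup>2 \<le> M" if "u \<in> V" for u
    unfolding M_def by (rule member_le_sum[OF that]) (auto simp: finite_V)
  let ?c = "\<lambda>u v t. cmod (level_phase t (f u) - s u v * level_phase t (f v))"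
  let ?b = "\<lambda>u v. (cmod (f u) + cmod (f v)) * cmod (f u - s u v * f v)"
  define I where "I = (\<lambda>u v. integral {0..M} (\<lambda>t. adj u v * ?c u v t))"
  \<comment> \<open>\<open>level_phase t\<close> commutes with multiplication by the unit number
    \<open>s u v\<close>, so on an edge \<open>level_phase_integral\<close> applies to
    \<open>f u\<close> and \<open>s u v * f v\<close>. Off the edges \<open>adj\<close>
    vanishes.\<close>
  have *: "(\<lambda>t. adj u v * ?c u v t) integrable_on {0..M} \<and> I u v \<le> adj u v * (3 / 2 * ?b u v)"
    if uv: "u \<in> V" "v \<in> V" for u v
  proof (cases "{u, v} \<in> E")
    case True
    have n: "cmod (s u v * f v) = cmod (f v)" using True by (simp add: norm_mult norm_signature)
    have "sgn (s u v) = s u v" using norm_signature[OF True] by (simp add: sgn_div_norm)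
    then have l: "level_phase t (s u v * f v) = s u v * level_phase t (f v)" for t
      by (simp add: level_phase_def n sgn_mult)
    have int: "?c u v integrable_on {0..M}" and le: "integral {0..M} (?c u v) \<le> 3 / 2 * ?b u v"
      using level_phase_integral[of "f u" M "s u v * f v"] M[OF uv(1)] M[OF uv(2)]
      unfolding l n by auto
    show ?thesis
      using integrable_on_mult_right[OF int, of "adj u v"] mult_left_mono[OF le adj_nonneg, of u v]
      by (simp add: I_def)
  qed (simp add: I_def adj_def integrable_0)
  have I: "((\<lambda>t. adj u v * ?c u v t) has_integral I u v) {0..M}" if "u \<in> V" "v \<in> V" for u v
    unfolding I_def using *[OF that] by (intro integrable_integral) simp
  have rhs: "((\<lambda>t. (\<Sum>u\<in>V. \<Sum>v\<in>V. adj u v * ?c u v t) / 2)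
      has_integral (\<Sum>u\<in>V. \<Sum>v\<in>V. I u v) / 2) {0..M}"
    by (rule has_integral_divide, rule has_integral_sum[OF finite_V],
        rule has_integral_sum[OF finite_V], rule I)
  have "((\<lambda>t. h * (\<Sum>u\<in>V. \<mu> u * (if t < (cmod (f u))\<^sup>2 then 1 else 0)))
      has_integral h * (\<Sum>u\<in>V. \<mu> u * (cmod (f u))\<^sup>2)) {0..M}"
    using M by (intro has_integral_mult_right has_integral_sum finite_V has_integral_level_indicator) auto
  then have lhs: "((\<lambda>t. h * (\<Sum>u\<in>V. \<mu> u * (if t < (cmod (f u))\<^sup>2 then 1 else 0)))
      has_integral h) {0..M}"
    using f(1) by (simp add: mform_self)
  have "h * (\<Sum>u\<in>V. \<mu> u * (if t < (cmod (f u))\<^sup>2 then 1 else 0))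
      \<le> (\<Sum>u\<in>V. \<Sum>v\<in>V. adj u v * ?c u v t) / 2" if t: "t \<in> {0..M}" for t
  proof -
    define V1 where "V1 = {u \<in> V. t < (cmod (f u))\<^sup>2}"
    have "(\<Sum>u\<in>V. \<mu> u * (if t < (cmod (f u))\<^sup>2 then 1 else 0)) = volume \<mu> V1"
      unfolding volume_def V1_def sum.inter_filter[OF finite_V] by (intro sum.cong) auto
    moreover have "cmod (level_phase t (f u)) = 1" if "u \<in> V1" for u
      using that t by (auto simp: V1_def level_phase_def norm_sgn)
    ultimately show ?thesis
      unfolding h_def using cheeger_constant_mult_volume_le[of V1 "\<lambda>u. level_phase t (f u)"]
      by (auto simp: V1_def level_phase_def)
  qed
  then have "h \<le> (\<Sum>u\<in>V. \<Sum>v\<in>V. I u v) / 2"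
    by (rule has_integral_le[OF lhs rhs])
  also have "\<dots> \<le> (\<Sum>u\<in>V. \<Sum>v\<in>V. adj u v * (3 / 2 * ?b u v)) / 2"
    using * by (intro divide_right_mono sum_mono) auto
  \<comment> \<open>The factor is 3/2 from the level integrals times 1/2 for the two
    orientations.\<close>
  also have "\<dots> = 3 / 4 * (\<Sum>u\<in>V. \<Sum>v\<in>V. adj u v * ?b u v)"
    by (simp add: sum_distrib_left sum_divide_distrib mult_ac)
  also have "\<dots> \<le> 3 / 4 * (sqrt (\<Sum>u\<in>V. \<Sum>v\<in>V. adj u v * (cmod (f u) + cmod (f v))\<^sup>2)
      * sqrt (\<Sum>u\<in>V. \<Sum>v\<in>V. adj u v * (cmod (f u - s u v * f v))\<^sup>2))"
    using weighted_cauchy_schwarz by simp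
  \<comment> \<open>The first sum is bounded by \<open>sum_adj_norm_add_le\<close> with
    \<open>mform f f = 1\<close>; the second is twice \<open>dform f f\<close>. The 4 leaves the
    root as 2 and turns 3/4 into 3/2.\<close>
  also have "\<dots> \<le> 3 / 4 * (sqrt (4 * max_degree V E w \<mu>) * sqrt (2 * lambda1 V E w \<mu> s))"
  proof -
    have "0 \<le> (\<Sum>u\<in>V. \<Sum>v\<in>V. adj u v * (cmod (f u) + cmod (f v))\<^sup>2)"
      by (intro sum_nonneg mult_nonneg_nonneg adj_nonneg) simp
    then have "0 \<le> max_degree V E w \<mu>" using sum_adj_norm_add_le[of f] f(1) by simp
    moreover have "0 \<le> lambda1 V E w \<mu> s" using dform_nonneg[of f] f(2) by simp
    ultimately show ?thesis
      using sum_adj_norm_add_le[of f] f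
      by (intro mult_left_mono mult_mono real_sqrt_le_mono)
        (auto simp: dform_self sum_nonneg adj_nonneg)
  qed
  also have "\<dots> = 3 / 2 * sqrt (2 * max_degree V E w \<mu> * lambda1 V E w \<mu> s)"
    by (simp add: real_sqrt_mult)
  finally show ?thesis by (simp add: h_def)
qed

end

theorem theorem4p6:
  fixes V :: "'a set" and E :: "'a set set" and w :: "'a \<Rightarrow> 'a \<Rightarrow> real"
    and \<mu> :: "'a \<Rightarrow> real" and s :: "'a \<Rightarrow> 'a \<Rightarrow> complex"
  assumes "simple_graph V E"
    and "edge_weight E w"
    and "\<forall>u\<in>V. 0 < \<mu> u"
    and "signature E s"
  shows "1 / 2 * lambda1 V E w \<mu> s \<le> cheeger_constant V E w \<mu> s
    \<and> cheeger_constant V E w \<mu> s \<le> 3 / 2 * sqrt (2 * max_degree V E w \<mu> * lambda1 V E w \<mu> s)"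
proof -
  interpret signed_graph V E w \<mu> s using assms by unfold_locales
  show ?thesis using cheeger_lower cheeger_upper by blast
qed

end
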